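(* As formal power series in $q$ (equivalently, for $|q|<1$), $$\sum_{n=0}^{\infty}a^{o}_{od}(n)q^n=\frac{(-q;q^2)_{\infty}}{(q^2;q^2)_{\infty}} \sum_{n=0}^{\infty} \frac{q^{2n^2+n}}{(-q;q^2)_{n+1}}$$ and $$\sum_{n=0}^{\infty}a^{e}_{od}(n)q^n=\frac{(-q;q^2)_{\infty}}{(q^2;q^2)_{\infty}} \left(v_2(q)-\sum_{n=0}^{\infty}\frac{q^{2n^2+n}}{(-q;q^2)_{n}}\right),$$ where $v_2(q):=\sum_{n=0}^{\infty}\frac{q^{2n^2-n}}{(-q;q^2)_n}$.
   Context: Notation: $(a;q)_0:=1$, $(a;q)_n:=\prod_{k=0}^{n-1}(1-aq^k)$, $(a;q)_\infty:=\lim_{n\to\infty}(a;q)_n$. For $n\ge 0$, $\mathcal{P}_{od}(n)$ is the set of all partitions of $n$ in which no odd part is repeated (each odd part appears at most once; even parts may appear with any multiplicity). The empty partition is the unique element of $\mathcal{P}_{od}(0)$. For a partition $\lambda$, $\mathrm{mex}(\lambda)$ is the smallest positive integer that is not a part of $\lambda$. Define $$a^{o}_{od}(n):=\#\{\lambda\in\mathcal{P}_{od}(n): \mathrm{mex}(\lambda)\equiv 1 \pmod 2\},\qquad a^{e}_{od}(n):=\#\{\lambda\in\mathcal{P}_{od}(n): \mathrm{mex}(\lambda)\equiv 0 \pmod 2\}.$$ *)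

theory Defs
  imports
    Complex_Main
    "HOL-Library.Multiset"
    "HOL-Computational_Algebra.Formal_Power_Series"
begin

definition qpoch :: "'a::comm_ring_1 \<Rightarrow> 'a \<Rightarrow> nat \<Rightarrow> 'a" where
  "qpoch a q n = (\<Prod>k<n. 1 - a * q ^ k)"

definition qpoch_inf :: "'a::{comm_ring_1,t2_space} \<Rightarrow> 'a \<Rightarrow> 'a" where
  "qpoch_inf a q = lim (\<lambda>n. qpoch a q n)"

text \<open>A partition is the multiset of its (positive) parts.\<close>

definition P_od :: "nat \<Rightarrow> nat multiset set" where
  "P_od n = {l. 0 \<notin># l \<and> sum_mset l = n \<and> (\<forall>i. odd i \<longrightarrow> count l i \<le> 1)}"

definition mex :: "nat multiset \<Rightarrow> nat" where
  "mex l = (LEAST m. 0 < m \<and> m \<notin># l)"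

definition a_od_o :: "nat \<Rightarrow> nat" where
  "a_od_o n = card {l \<in> P_od n. odd (mex l)}"

definition a_od_e :: "nat \<Rightarrow> nat" where
  "a_od_e n = card {l \<in> P_od n. even (mex l)}"

abbreviation q :: "rat fps" where
  "q \<equiv> fps_X"

definition v2 :: "rat fps" where
  "v2 = (\<Sum>n. q ^ (2 * n\<^sup>2 - n) / qpoch (- q) (q\<^sup>2) n)"

text \<open>
  The operators \<^const>\<open>lim\<close>, \<^const>\<open>suminf\<close> and \<^const>\<open>card\<close> return junk values on divergent
  sequences and infinite sets. The following facts show that this does not happen here: limits and
  sums are taken in the metric of formal power series, where convergence means that every
  coefficient is eventually constant.
\<close>

lemma finite_P_od: "finite (P_od n)"
proof (rule finite_subset)
  show "P_od n \<subseteq> (\<Union>k\<in>{..n}. multisets_of_size {..n} k)"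
  proof
    fix l assume l: "l \<in> P_od n"
    have "1 \<le> x" if "x \<in># l" for x
      using l that by (cases x) (auto simp: P_od_def)
    hence "(\<Sum>x\<in>#l. 1) \<le> (\<Sum>x\<in>#l. x)"
      by (rule sum_mset_mono)
    hence "size l \<le> n"
      using l by (simp add: P_od_def)
    moreover have "set_mset l \<subseteq> {..n}"
      using l by (auto simp: P_od_def dest!: multi_member_split)
    ultimately show "l \<in> (\<Union>k\<in>{..n}. multisets_of_size {..n} k)"
      by (auto simp: multisets_of_size_def)
  qed
  show "finite (\<Union>k\<in>{..n}. multisets_of_size {..n} k)"
    by auto
qed

lemma convergent_fpsI:
  fixes s :: "nat \<Rightarrow> 'a::comm_ring_1 fps"
  assumes "\<And>n k. n \<le> k \<Longrightarrow> fps_nth (s (Suc k)) n = fps_nth (s k) n"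
  shows "convergent s"
proof (rule convergentI)
  have eq: "fps_nth (s k) n = fps_nth (s n) n" if "n \<le> k" for n k
    using that by (induction k rule: dec_induct) (auto simp: assms)
  show "s \<longlonglongrightarrow> Abs_fps (\<lambda>n. fps_nth (s n) n)"
    unfolding tendsto_fps_iff eventually_sequentially fps_nth_Abs_fps using eq by blast
qed

lemma convergent_qpoch_fps:
  fixes a :: "rat fps"
  assumes "fps_nth a 0 = 0"
  shows "convergent (qpoch a (q\<^sup>2))"
proof (rule convergent_fpsI)
  fix n k :: nat assume "n \<le> k"
  have "qpoch a (q\<^sup>2) (Suc k) = qpoch a (q\<^sup>2) k - q ^ (2 * k) * (a * qpoch a (q\<^sup>2) k)"
    by (simp add: qpoch_def algebra_simps flip: power_mult)
  moreover have "fps_nth (q ^ (2 * k) * (a * qpoch a (q\<^sup>2) k)) n = 0"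
    using \<open>n \<le> k\<close> assms by (cases "n = 0") (auto simp: fps_X_power_mult_nth)
  ultimately show "fps_nth (qpoch a (q\<^sup>2) (Suc k)) n = fps_nth (qpoch a (q\<^sup>2) k) n"
    by simp
qed

lemma qpoch_nth_0: "fps_nth (qpoch (- q) (q\<^sup>2) m) 0 = 1"
  by (induction m) (auto simp: qpoch_def)

lemma summable_fps_X_power_div_qpoch:
  assumes "\<And>n. n \<le> e n"
  shows "summable (\<lambda>n. q ^ e n / qpoch (- q) (q\<^sup>2) (m n))"
proof -
  let ?t = "\<lambda>n. q ^ e n / qpoch (- q) (q\<^sup>2) (m n)"
  have "fps_nth (?t k) n = 0" if "n < k" for n k
  proof -
    have "?t k = q ^ e k * inverse (qpoch (- q) (q\<^sup>2) (m k))"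
      by (simp add: fps_divide_unit qpoch_nth_0)
    thus ?thesis
      using that assms[of k] by (simp add: fps_X_power_mult_nth)
  qed
  hence "convergent (\<lambda>N. \<Sum>n<Suc N. ?t n)"
    by (intro convergent_fpsI) simp
  thus ?thesis
    unfolding summable_iff_convergent
    by (subst (asm) convergent_Suc_iff[where f = "\<lambda>N. \<Sum>n<N. ?t n"])
qed

end

theory Submission
  imports Defs
begin

text \<open>
  Fix the value \<open>m\<close> of the mex. Parts below \<open>m\<close> must occur, \<open>m\<close> itself must not, and larger parts
  are as free as in \<open>P_od\<close>. So if \<open>b\<^sub>i\<close> is the factor of the generating function of \<open>P_od\<close> that belongs
  to part \<open>i\<close>, then prescribing the mex replaces \<open>b\<^sub>i\<close> by \<open>b\<^sub>i - 1\<close> for \<open>i < m\<close> and \<open>b\<^sub>m\<close> by \<open>1\<close>.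
  Now \<open>b\<^sub>i\<close> is \<open>1 + q^i\<close> for odd and \<open>1 / (1 - q^i)\<close> for even \<open>i\<close>; writing both as \<open>n\<^sub>i / d\<^sub>i\<close> one has
  \<open>n\<^sub>i - d\<^sub>i = q^i\<close> in either case. Hence \<open>m\<close> contributes
  \<open>q^(0 + 1 + \<dots> + (m - 1)) d\<^sub>m / (-q;q\<^sup>2)\<^bsub>\<lceil>m/2\<rceil>\<^esub>\<close> times the full product
  \<open>(-q;q\<^sup>2)\<^sub>\<infinity> / (q\<^sup>2;q\<^sup>2)\<^sub>\<infinity>\<close>, and it remains to sum over odd and over even \<open>m\<close>.
\<close>

section \<open>Limits of formal power series\<close>

instance fps :: (ring) topological_semigroup_mult
proof
  fix f g :: "'a fps"
  show "((\<lambda>x. fst x * snd x) \<longlongrightarrow> f * g) (nhds f \<times>\<^sub>F nhds g)"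
  proof (rule tendsto_fpsI)
    fix n
    have "\<forall>\<^sub>F x in nhds f \<times>\<^sub>F nhds g. (\<forall>k\<le>n. fps_nth (fst x) k = fps_nth f k) \<and>
        (\<forall>k\<le>n. fps_nth (snd x) k = fps_nth g k)"
      by (intro eventually_prodI eventually_fps_nth_eq_nhds_fps_strong)
    thus "\<forall>\<^sub>F x in nhds f \<times>\<^sub>F nhds g. fps_nth (fst x * snd x) n = fps_nth (f * g) n"
      by eventually_elim (simp add: fps_mult_nth)
  qed
qed

instance fps :: (ab_group_add) topological_ab_group_add
proof
  fix f g :: "'a fps"
  show "((\<lambda>x. fst x + snd x) \<longlongrightarrow> f + g) (nhds f \<times>\<^sub>F nhds g)"
  proof (rule tendsto_fpsI)
    fix n
    have "\<forall>\<^sub>F x in nhds f \<times>\<^sub>F nhds g. fps_nth (fst x) n = fps_nth f n \<and> fps_nth (snd x) n = fps_nth g n"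
      by (intro eventually_prodI eventually_fps_nth_eq_nhds_fps)
    thus "\<forall>\<^sub>F x in nhds f \<times>\<^sub>F nhds g. fps_nth (fst x + snd x) n = fps_nth (f + g) n"
      by eventually_elim simp
  qed
  show "(uminus \<longlongrightarrow> - f) (nhds f)"
  proof (rule tendsto_fpsI)
    fix n
    show "\<forall>\<^sub>F h in nhds f. fps_nth (- h) n = fps_nth (- f) n"
      using eventually_fps_nth_eq_nhds_fps[of n f] by eventually_elim simp
  qed
qed

lemma sums_mult_left_topological:
  fixes f :: "nat \<Rightarrow> 'a::{topological_semigroup_mult, semiring_0}"
  assumes "f sums s"
  shows "(\<lambda>n. c * f n) sums (c * s)"
  using tendsto_mult[OF tendsto_const assms[unfolded sums_def]]
  by (simp add: sums_def sum_distrib_left)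

lemma sums_diff_topological:
  fixes f g :: "nat \<Rightarrow> 'a::topological_ab_group_add"
  assumes "f sums s" "g sums t"
  shows "(\<lambda>n. f n - g n) sums (s - t)"
  using tendsto_diff[OF assms[unfolded sums_def]] by (simp add: sums_def sum_subtractf)

lemma sums_gf_by_statistic:
  fixes A :: "nat \<Rightarrow> 'a set" and s :: "'a \<Rightarrow> 'b"
  assumes fin: "\<And>n. finite (A n)" and inj: "inj f"
  shows "(\<lambda>k. Abs_fps (\<lambda>n. of_nat (card {x \<in> A n. s x = f k}))) sums
    (Abs_fps (\<lambda>n. of_nat (card {x \<in> A n. s x \<in> range f})) :: 'c::ring_1 fps)"
  unfolding sums_def
proof (rule tendsto_fpsI)
  fix n
  have "finite (f -` s ` A n)"
    using fin inj by (intro finite_vimageI) auto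
  then obtain K where K: "\<And>k. f k \<in> s ` A n \<Longrightarrow> k < K"
    unfolding finite_nat_set_iff_bounded by blast
  have "(\<Sum>k<N. card {x \<in> A n. s x = f k}) = card {x \<in> A n. s x \<in> range f}" if "K \<le> N" for N
  proof -
    have "{x \<in> A n. s x \<in> range f} = (\<Union>k<N. {x \<in> A n. s x = f k})"
      using K that by force
    also have "card \<dots> = (\<Sum>k<N. card {x \<in> A n. s x = f k})"
      using fin inj by (intro card_UN_disjoint) (auto dest: injD)
    finally show ?thesis ..
  qed
  hence "\<forall>\<^sub>F N in sequentially. (\<Sum>k<N. card {x \<in> A n. s x = f k}) = card {x \<in> A n. s x \<in> range f}"
    unfolding eventually_sequentially by blast
  thus "\<forall>\<^sub>F N in sequentially.
      fps_nth (\<Sum>k<N. Abs_fps (\<lambda>n. of_nat (card {x \<in> A n. s x = f k})) :: 'c fps) n =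
      fps_nth (Abs_fps (\<lambda>n. of_nat (card {x \<in> A n. s x \<in> range f}))) n"
    by eventually_elim (simp add: fps_sum_nth flip: of_nat_sum)
qed

section \<open>Partitions with prescribed multiplicities\<close>

definition partitions_with_mults :: "(nat \<Rightarrow> nat set) \<Rightarrow> nat \<Rightarrow> nat multiset set" where
  "partitions_with_mults C n = {l. 0 \<notin># l \<and> sum_mset l = n \<and> (\<forall>i>0. count l i \<in> C i)}"

definition partition_gf :: "(nat \<Rightarrow> nat set) \<Rightarrow> 'a::semiring_1 fps" where
  "partition_gf C = Abs_fps (\<lambda>n. of_nat (card (partitions_with_mults C n)))"

definition part_gf :: "nat set \<Rightarrow> nat \<Rightarrow> 'a::semiring_1 fps" where
  "part_gf K i = Abs_fps (\<lambda>n. of_bool (n \<in> (*) i ` K))"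

lemma part_gf_0: "i > 0 \<Longrightarrow> part_gf {0} i = 1"
  by (auto simp: part_gf_def fps_eq_iff)

lemma part_gf_0_1: "i > 0 \<Longrightarrow> part_gf {0, 1} i = 1 + fps_X ^ i"
  by (auto simp: part_gf_def fps_eq_iff fps_X_power_iff)

lemma part_gf_UNIV: "i > 0 \<Longrightarrow> part_gf UNIV i * (1 - fps_X ^ i) = (1 :: 'a::comm_ring_1 fps)"
  by (auto simp: part_gf_def fps_eq_iff fps_X_power_mult_right_nth right_diff_distrib
      dvd_imp_le dvd_minus_self image_iff simp flip: dvd_def)

lemma part_gf_remove_0: "i > 0 \<Longrightarrow> 0 \<in> K \<Longrightarrow> part_gf (K - {0}) i = (part_gf K i - 1 :: 'a::ring_1 fps)"
  by (auto simp: part_gf_def fps_eq_iff)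

text \<open>
  Replacing each part \<open>i\<close> by \<open>i\<close> copies of itself turns a partition of \<open>n\<close> into a multiset of size
  \<open>n\<close> in which the multiplicity of \<open>i\<close> is the exponent taken from the \<open>i\<close>-th factor of the product.
  Such multisets index the coefficients of products in \<open>fps_prod_nth'\<close>.
\<close>

definition part_weights :: "nat multiset \<Rightarrow> nat multiset" where
  "part_weights l = (\<Sum>i\<in>#l. replicate_mset i i)"

lemma count_part_weights: "count (part_weights l) i = i * count l i"
  by (induction l) (auto simp: part_weights_def)

lemma size_part_weights: "size (part_weights l) = sum_mset l"
  by (induction l) (auto simp: part_weights_def)

lemma set_mset_part_weights: "set_mset (part_weights l) = set_mset l - {0}"
  by (auto simp: count_part_weights simp flip: count_greater_zero_iff)

lemma member_le_sum_mset: "i \<in># l \<Longrightarrow> i \<le> sum_mset l" for i :: nat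
  by (auto dest!: multi_member_split)

lemma inj_on_part_weights: "inj_on part_weights {l. 0 \<notin># l}"
proof (rule inj_onI, rule multiset_eqI)
  fix l l' i
  assume "l \<in> {l. 0 \<notin># l}" "l' \<in> {l. 0 \<notin># l}" and "part_weights l = part_weights l'"
  hence "i * count l i = i * count l' i" "i = 0 \<longrightarrow> i \<notin># l \<and> i \<notin># l'"
    by (auto simp flip: count_part_weights)
  thus "count l i = count l' i"
    by (cases "i = 0") (simp_all add: not_in_iff)
qed

lemma part_weights_image_partitions_with_mults:
  assumes "n \<le> N" and free: "\<And>i. i > N \<Longrightarrow> 0 \<in> C i"
  shows "part_weights ` partitions_with_mults C n =
    {X \<in> multisets_of_size {0<..N} n. \<forall>i\<in>{0<..N}. count X i \<in> (*) i ` C i}" (is "_ = ?W")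
proof (intro equalityI subsetI)
  fix X assume "X \<in> part_weights ` partitions_with_mults C n"
  then obtain l where X: "X = part_weights l" and l: "l \<in> partitions_with_mults C n"
    by blast
  have "0 < i \<and> i \<le> n" if "i \<in># X" for i
    using that l member_le_sum_mset[of i l]
    by (auto simp: X set_mset_part_weights partitions_with_mults_def)
  hence "set_mset X \<subseteq> {0<..n}" by auto
  thus "X \<in> ?W"
    using l assms(1) by (auto simp: X multisets_of_size_def partitions_with_mults_def
        size_part_weights count_part_weights)
next
  fix X assume X: "X \<in> ?W"
  then obtain k where k: "\<And>i. i \<in> {0<..N} \<Longrightarrow> k i \<in> C i" "\<And>i. i \<in> {0<..N} \<Longrightarrow> count X i = i * k i"
    unfolding image_iff mem_Collect_eq Bex_def by metis
  define l where "l = (\<Sum>i\<in>{0<..N}. replicate_mset (k i) i)"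
  have count_l: "count l i = (if i \<in> {0<..N} then k i else 0)" for i
    by (auto simp: l_def count_sum)
  have X_eq: "X = part_weights l"
  proof (rule multiset_eqI)
    fix i
    have "count X i = 0" if "i \<notin> {0<..N}"
      using X that by (auto simp: multisets_of_size_def not_in_iff[symmetric])
    thus "count X i = count (part_weights l) i"
      using k(2) by (simp add: count_part_weights count_l)
  qed
  moreover have "l \<in> partitions_with_mults C n"
    using X k(1) free by (auto simp: partitions_with_mults_def multisets_of_size_def count_l X_eq
        size_part_weights not_in_iff)
  ultimately show "X \<in> part_weights ` partitions_with_mults C n"
    by blast
qed

lemma card_partitions_with_mults:
  assumes "n \<le> N" and "\<And>i. i > N \<Longrightarrow> 0 \<in> C i"
  shows "card (partitions_with_mults C n) =
    card {X \<in> multisets_of_size {0<..N} n. \<forall>i\<in>{0<..N}. count X i \<in> (*) i ` C i}"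
proof -
  have "inj_on part_weights (partitions_with_mults C n)"
    by (rule inj_on_subset[OF inj_on_part_weights]) (auto simp: partitions_with_mults_def)
  hence "card (part_weights ` partitions_with_mults C n) = card (partitions_with_mults C n)"
    by (rule card_image)
  thus ?thesis
    by (simp only: part_weights_image_partitions_with_mults[OF assms])
qed

lemma prod_of_bool: "finite A \<Longrightarrow> (\<Prod>x\<in>A. of_bool (P x)) = (of_bool (\<forall>x\<in>A. P x) :: 'a::comm_semiring_1)"
  by (induction A rule: finite_induct) auto

lemma partition_gf_nth:
  assumes "n \<le> N" and "\<And>i. i > N \<Longrightarrow> 0 \<in> C i"
  shows "fps_nth (partition_gf C) n = fps_nth (\<Prod>i\<in>{0<..N}. part_gf (C i) i :: 'a::comm_semiring_1 fps) n"
proof -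
  have "fps_nth (\<Prod>i\<in>{0<..N}. part_gf (C i) i :: 'a fps) n =
      (\<Sum>X\<in>multisets_of_size {0<..N} n. of_bool (\<forall>i\<in>{0<..N}. count X i \<in> (*) i ` C i))"
    by (simp add: fps_prod_nth' part_gf_def prod_of_bool)
  also have "\<dots> = of_nat (card {X \<in> multisets_of_size {0<..N} n. \<forall>i\<in>{0<..N}. count X i \<in> (*) i ` C i})"
    by (subst sum_of_bool_eq) (auto simp: Int_def)
  also have "\<dots> = fps_nth (partition_gf C) n"
    by (simp add: partition_gf_def card_partitions_with_mults[OF assms])
  finally show ?thesis ..
qed

theorem prod_part_gf_tendsto_partition_gf:
  assumes "\<forall>\<^sub>F i in sequentially. 0 \<in> C i"
  shows "(\<lambda>N. \<Prod>i\<in>{0<..N}. part_gf (C i) i) \<longlonglongrightarrow> (partition_gf C :: 'a::comm_ring_1 fps)"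
proof (rule tendsto_fpsI)
  fix n
  from assms obtain K where K: "\<And>i. i \<ge> K \<Longrightarrow> 0 \<in> C i"
    unfolding eventually_sequentially by blast
  show "\<forall>\<^sub>F N in sequentially. fps_nth (\<Prod>i\<in>{0<..N}. part_gf (C i) i :: 'a fps) n =
      fps_nth (partition_gf C) n"
    using eventually_ge_at_top[of "max K n"]
    by eventually_elim (intro partition_gf_nth[symmetric] K; simp)
qed

lemma partition_gf_mult_prod_part_gf:
  assumes "\<forall>\<^sub>F i in sequentially. 0 \<in> C i" and agree: "\<And>i. i > m \<Longrightarrow> C i = C' i"
  shows "partition_gf C * (\<Prod>i\<in>{0<..m}. part_gf (C' i) i) =
    partition_gf C' * (\<Prod>i\<in>{0<..m}. part_gf (C i) i :: 'a::comm_ring_1 fps)"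
proof (rule LIMSEQ_unique)
  let ?prod = "\<lambda>C N. \<Prod>i\<in>{0<..N}. part_gf (C i) i :: 'a fps"
  show "(\<lambda>N. ?prod C N * ?prod C' m) \<longlonglongrightarrow> partition_gf C * ?prod C' m"
    by (intro tendsto_intros prod_part_gf_tendsto_partition_gf assms)
  have "\<forall>\<^sub>F i in sequentially. 0 \<in> C' i"
    using assms(1) eventually_gt_at_top[of m] by eventually_elim (simp add: agree)
  hence "(\<lambda>N. ?prod C' N * ?prod C m) \<longlonglongrightarrow> partition_gf C' * ?prod C m"
    by (intro tendsto_intros prod_part_gf_tendsto_partition_gf)
  moreover have "\<forall>\<^sub>F N in sequentially. ?prod C' N * ?prod C m = ?prod C N * ?prod C' m"
    using eventually_ge_at_top[of m]
  proof eventually_elim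
    case (elim N)
    have split: "?prod D N = ?prod D m * (\<Prod>i\<in>{m<..N}. part_gf (D i) i)" for D
      using elim by (subst prod.union_disjoint[symmetric]) (auto intro!: prod.cong)
    have "(\<Prod>i\<in>{m<..N}. part_gf (C i) i) = (\<Prod>i\<in>{m<..N}. part_gf (C' i) i :: 'a fps)"
      by (simp add: agree)
    thus ?case
      by (simp only: split[of C] split[of C'] mult_ac)
  qed
  ultimately show "(\<lambda>N. ?prod C N * ?prod C' m) \<longlonglongrightarrow> partition_gf C' * ?prod C m"
    by (rule Lim_transform_eventually)
qed

section \<open>Partitions with prescribed mex\<close>

lemma mex_pos: "mex l > 0" and mex_notin: "mex l \<notin># l"
proof -
  have "infinite ({0<..} :: nat set)"
    by (rule infinite_Ioi)
  hence "\<not> {0<..} \<subseteq> set_mset l"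
    using finite_subset by blast
  hence "\<exists>x>0. x \<notin># l"
    by blast
  from LeastI_ex[OF this] show "mex l > 0" "mex l \<notin># l"
    by (simp_all add: mex_def)
qed

lemma mem_if_less_mex: "0 < i \<Longrightarrow> i < mex l \<Longrightarrow> i \<in># l"
  using not_less_Least[of i "\<lambda>m. 0 < m \<and> m \<notin># l"] by (auto simp: mex_def)

lemma mex_eq_iff:
  assumes "m > 0"
  shows "mex l = m \<longleftrightarrow> m \<notin># l \<and> (\<forall>i. 0 < i \<and> i < m \<longrightarrow> i \<in># l)"
  using assms mex_pos[of l] mex_notin[of l] mem_if_less_mex[of _ l]
  by (metis linorder_neqE_nat)

definition restrict_mex :: "nat \<Rightarrow> (nat \<Rightarrow> nat set) \<Rightarrow> nat \<Rightarrow> nat set" where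
  "restrict_mex m C i = (if i < m then C i - {0} else if i = m then {0} else C i)"

lemma restrict_mex_above: "m < i \<Longrightarrow> restrict_mex m C i = C i"
  by (simp add: restrict_mex_def)

lemma partitions_with_mults_restrict_mex:
  assumes "m > 0" "0 \<in> C m"
  shows "partitions_with_mults (restrict_mex m C) n = {l \<in> partitions_with_mults C n. mex l = m}"
proof -
  have "count l i \<in> restrict_mex m C i \<longleftrightarrow>
      count l i \<in> C i \<and> (i < m \<longrightarrow> i \<in># l) \<and> (i = m \<longrightarrow> i \<notin># l)" for l i
    using assms(2) by (auto simp: restrict_mex_def not_in_iff)
  hence "(\<forall>i>0. count l i \<in> restrict_mex m C i) \<longleftrightarrow> (\<forall>i>0. count l i \<in> C i) \<and> mex l = m" for l
    unfolding mex_eq_iff[OF assms(1)] using assms(1) by blast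
  thus ?thesis
    by (auto simp: partitions_with_mults_def)
qed

lemma partition_gf_restrict_mex:
  assumes "m > 0" and "\<And>i. 0 \<in> C i"
  shows "partition_gf (restrict_mex m C) * (\<Prod>i\<in>{0<..m}. part_gf (C i) i) =
    partition_gf C * (\<Prod>i\<in>{0<..<m}. part_gf (C i) i - 1 :: 'a::comm_ring_1 fps)"
proof -
  have "(\<Prod>i\<in>{0<..m}. part_gf (restrict_mex m C i) i) = (\<Prod>i\<in>{0<..<m}. part_gf (C i) i - 1 :: 'a fps)"
  proof (rule prod.mono_neutral_cong_right)
    show "\<forall>i\<in>{0<..m} - {0<..<m}. part_gf (restrict_mex m C i) i = (1 :: 'a fps)"
      by (auto simp: restrict_mex_def part_gf_0)
  qed (use assms in \<open>auto simp: restrict_mex_def part_gf_remove_0\<close>)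
  moreover have "\<forall>\<^sub>F i in sequentially. 0 \<in> restrict_mex m C i"
    using eventually_gt_at_top[of m] by eventually_elim (simp add: restrict_mex_above assms(2))
  hence "partition_gf (restrict_mex m C) * (\<Prod>i\<in>{0<..m}. part_gf (C i) i) =
      partition_gf C * (\<Prod>i\<in>{0<..m}. part_gf (restrict_mex m C i) i :: 'a fps)"
    by (rule partition_gf_mult_prod_part_gf) (rule restrict_mex_above)
  ultimately show ?thesis by simp
qed

section \<open>Partitions without repeated odd parts\<close>

definition pod_mults :: "nat \<Rightarrow> nat set" where
  "pod_mults i = (if odd i then {0, 1} else UNIV)"

lemma zero_in_pod_mults: "0 \<in> pod_mults i"
  by (simp add: pod_mults_def)

definition pod_numer :: "'a::comm_ring_1 \<Rightarrow> nat \<Rightarrow> 'a" where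
  "pod_numer x i = (if odd i then 1 + x ^ i else 1)"

definition pod_denom :: "'a::comm_ring_1 \<Rightarrow> nat \<Rightarrow> 'a" where
  "pod_denom x i = (if even i then 1 - x ^ i else 1)"

lemma P_od_eq_partitions_with_mults: "P_od n = partitions_with_mults pod_mults n"
  by (auto simp: P_od_def partitions_with_mults_def pod_mults_def le_Suc_eq odd_pos)

lemma part_gf_pod_mults: "i > 0 \<Longrightarrow> part_gf (pod_mults i) i * pod_denom fps_X i = pod_numer fps_X i"
  by (simp add: pod_mults_def pod_numer_def pod_denom_def part_gf_UNIV part_gf_0_1
      del: One_nat_def)

lemma part_gf_pod_mults_minus_1:
  "i > 0 \<Longrightarrow> (part_gf (pod_mults i) i - 1) * pod_denom fps_X i = fps_X ^ i"
  by (simp add: left_diff_distrib part_gf_pod_mults) (simp add: pod_numer_def pod_denom_def)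

lemma prod_greaterThan_0_atMost_Suc: "prod f {0<..Suc N} = prod f {0<..N} * f (Suc N)"
  using prod.nat_ivl_Suc'[of "Suc 0" N f] by (simp add: atLeastSucAtMost_greaterThanAtMost mult.commute)

lemma prod_pod_numer: "(\<Prod>i\<in>{0<..N}. pod_numer x i) = qpoch (- x) (x\<^sup>2) ((N + 1) div 2)"
proof (induction N)
  case (Suc N)
  show ?case
  proof (cases "even N")
    case False
    thus ?thesis using Suc by (simp add: prod_greaterThan_0_atMost_Suc pod_numer_def)
  next
    case True
    then obtain j where "N = 2 * j" by (elim evenE)
    thus ?thesis using Suc by (simp add: prod_greaterThan_0_atMost_Suc pod_numer_def qpoch_def power_mult)
  qed
qed (simp add: qpoch_def)

lemma prod_pod_denom: "(\<Prod>i\<in>{0<..N}. pod_denom x i) = qpoch (x\<^sup>2) (x\<^sup>2) (N div 2)"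
proof (induction N)
  case (Suc N)
  show ?case
  proof (cases "even N")
    case True
    thus ?thesis using Suc by (simp add: prod_greaterThan_0_atMost_Suc pod_denom_def)
  next
    case False
    then obtain j where "N = 2 * j + 1" by (elim oddE)
    thus ?thesis using Suc
      by (simp add: prod_greaterThan_0_atMost_Suc pod_denom_def qpoch_def power_mult power2_eq_square mult.assoc)
  qed
qed (simp add: qpoch_def)

lemma qpoch_tendsto_inf:
  fixes a :: "rat fps"
  assumes "fps_nth a 0 = 0"
  shows "qpoch a (q\<^sup>2) \<longlonglongrightarrow> qpoch_inf a (q\<^sup>2)"
  using convergent_qpoch_fps[OF assms] by (simp add: convergent_LIMSEQ_iff qpoch_inf_def)

lemma qpoch_inf_nth_0:
  fixes a :: "rat fps"
  assumes "fps_nth a 0 = 0"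
  shows "fps_nth (qpoch_inf a (q\<^sup>2)) 0 = 1"
proof -
  have "fps_nth (qpoch a (q\<^sup>2) n) 0 = 1" for n
    using assms by (induction n) (auto simp: qpoch_def)
  moreover have "\<forall>\<^sub>F n in sequentially. fps_nth (qpoch a (q\<^sup>2) n) 0 = fps_nth (qpoch_inf a (q\<^sup>2)) 0"
    using qpoch_tendsto_inf[OF assms] by (simp add: tendsto_fps_iff)
  ultimately show ?thesis by simp
qed

lemma partition_gf_pod_mults:
  "partition_gf pod_mults = qpoch_inf (- q) (q\<^sup>2) / qpoch_inf (q\<^sup>2) (q\<^sup>2)"
proof -
  let ?prod = "\<lambda>M. \<Prod>i\<in>{0<..2*M}. part_gf (pod_mults i) i :: rat fps"
  have "(\<lambda>N. \<Prod>i\<in>{0<..N}. part_gf (pod_mults i) i) \<longlonglongrightarrow> (partition_gf pod_mults :: rat fps)"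
    by (rule prod_part_gf_tendsto_partition_gf) (simp add: zero_in_pod_mults)
  hence "?prod \<longlonglongrightarrow> partition_gf pod_mults"
    by (rule filterlim_compose) (simp add: filterlim_subseq strict_mono_def)
  hence "(\<lambda>M. ?prod M * qpoch (q\<^sup>2) (q\<^sup>2) M) \<longlonglongrightarrow> partition_gf pod_mults * qpoch_inf (q\<^sup>2) (q\<^sup>2)"
    by (intro tendsto_intros qpoch_tendsto_inf) simp_all
  moreover have "?prod M * qpoch (q\<^sup>2) (q\<^sup>2) M = qpoch (- q) (q\<^sup>2) M" for M
  proof -
    have "?prod M * (\<Prod>i\<in>{0<..2*M}. pod_denom q i) = (\<Prod>i\<in>{0<..2*M}. pod_numer q i)"
      by (simp add: part_gf_pod_mults flip: prod.distrib)
    thus ?thesis by (simp add: prod_pod_numer prod_pod_denom)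
  qed
  moreover have "qpoch (- q) (q\<^sup>2) \<longlonglongrightarrow> qpoch_inf (- q) (q\<^sup>2)"
    by (rule qpoch_tendsto_inf) simp
  ultimately have "qpoch_inf (- q) (q\<^sup>2) = partition_gf pod_mults * qpoch_inf (q\<^sup>2) (q\<^sup>2)"
    using LIMSEQ_unique by auto
  moreover have "qpoch_inf (q\<^sup>2) (q\<^sup>2) \<noteq> 0"
    using qpoch_inf_nth_0[of "q\<^sup>2"] by auto
  ultimately show ?thesis by simp
qed

definition pod_mex_gf :: "nat \<Rightarrow> rat fps" where
  "pod_mex_gf m = Abs_fps (\<lambda>n. of_nat (card {l \<in> P_od n. mex l = m}))"

lemma pod_mex_gf_0: "pod_mex_gf 0 = 0"
  using mex_pos by (simp add: pod_mex_gf_def fps_eq_iff less_imp_neq[THEN not_sym])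

lemma pod_mex_gf_eq_partition_gf:
  "m > 0 \<Longrightarrow> pod_mex_gf m = partition_gf (restrict_mex m pod_mults)"
  by (simp add: pod_mex_gf_def partition_gf_def P_od_eq_partitions_with_mults
      partitions_with_mults_restrict_mex zero_in_pod_mults)

lemma pod_mex_gf_mult_qpoch:
  assumes "m > 0"
  shows "pod_mex_gf m * qpoch (- q) (q\<^sup>2) ((m + 1) div 2) =
    partition_gf pod_mults * (q ^ (\<Sum>i<m. i) * pod_denom q m)"
proof -
  let ?b = "\<lambda>i. part_gf (pod_mults i) i :: rat fps"
  have interval: "{0<..m} = insert m {0<..<m}"
    using assms by auto
  have "pod_mex_gf m * qpoch (- q) (q\<^sup>2) ((m + 1) div 2) =
      pod_mex_gf m * (\<Prod>i\<in>{0<..m}. ?b i) * (\<Prod>i\<in>{0<..m}. pod_denom q i)"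
    by (simp only: prod_pod_numer[symmetric] mult.assoc prod.distrib[symmetric])
      (simp add: part_gf_pod_mults)
  also have "\<dots> = partition_gf pod_mults * (\<Prod>i\<in>{0<..<m}. ?b i - 1) * (\<Prod>i\<in>{0<..m}. pod_denom q i)"
    using assms by (simp add: pod_mex_gf_eq_partition_gf partition_gf_restrict_mex zero_in_pod_mults)
  also have "\<dots> = partition_gf pod_mults * ((\<Prod>i\<in>{0<..<m}. (?b i - 1) * pod_denom q i) * pod_denom q m)"
    by (simp add: interval prod.distrib mult_ac)
  also have "(\<Prod>i\<in>{0<..<m}. (?b i - 1) * pod_denom q i) = (\<Prod>i<m. q ^ i)"
    by (intro prod.mono_neutral_cong_left) (auto simp: part_gf_pod_mults_minus_1)
  also have "\<dots> = q ^ (\<Sum>i<m. i)"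
    by (simp add: power_sum)
  finally show ?thesis .
qed

lemma pod_mex_gf_eq:
  "pod_mex_gf m = qpoch_inf (- q) (q\<^sup>2) / qpoch_inf (q\<^sup>2) (q\<^sup>2) *
     (q ^ (\<Sum>i<m. i) * pod_denom q m / qpoch (- q) (q\<^sup>2) ((m + 1) div 2))"
proof (cases "m = 0")
  case True
  thus ?thesis by (simp add: pod_mex_gf_0 pod_denom_def)
next
  case False
  let ?D = "qpoch (- q) (q\<^sup>2) ((m + 1) div 2)"
  have "pod_mex_gf m = pod_mex_gf m * ?D * inverse ?D"
    by (simp add: mult.assoc inverse_mult_eq_1' qpoch_nth_0)
  also have "\<dots> = partition_gf pod_mults * (q ^ (\<Sum>i<m. i) * pod_denom q m) * inverse ?D"
    using False by (simp only: pod_mex_gf_mult_qpoch)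
  finally show ?thesis
    by (simp add: partition_gf_pod_mults fps_divide_unit qpoch_nth_0 mult.assoc)
qed

lemma sum_lessThan_odd: "(\<Sum>i<2 * k + 1. i) = 2 * k\<^sup>2 + (k :: nat)"
  by (induction k) (auto simp: power2_eq_square)

lemma sum_lessThan_even: "(\<Sum>i<2 * k. i) = 2 * k\<^sup>2 - (k :: nat)"
  using sum_lessThan_odd[of k] by simp

lemma le_twice_square_minus: "k \<le> 2 * k\<^sup>2 - (k :: nat)"
  by (cases k) (auto simp: power2_eq_square)

lemma pod_mex_gf_odd:
  "pod_mex_gf (2 * k + 1) = qpoch_inf (- q) (q\<^sup>2) / qpoch_inf (q\<^sup>2) (q\<^sup>2) *
     (q ^ (2 * k\<^sup>2 + k) / qpoch (- q) (q\<^sup>2) (k + 1))"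
  unfolding pod_mex_gf_eq sum_lessThan_odd by (simp add: pod_denom_def)

lemma pod_mex_gf_even:
  "pod_mex_gf (2 * k) = qpoch_inf (- q) (q\<^sup>2) / qpoch_inf (q\<^sup>2) (q\<^sup>2) *
     (q ^ (2 * k\<^sup>2 - k) / qpoch (- q) (q\<^sup>2) k - q ^ (2 * k\<^sup>2 + k) / qpoch (- q) (q\<^sup>2) k)"
proof -
  have exponent: "2 * k\<^sup>2 + k = (2 * k\<^sup>2 - k) + 2 * k"
    using le_twice_square_minus[of k] by (cases k) auto
  show ?thesis
    unfolding pod_mex_gf_eq sum_lessThan_even exponent power_add
    by (simp add: pod_denom_def fps_divide_unit qpoch_nth_0 algebra_simps)
qed

lemma sums_pod_mex_gf_odd: "(\<lambda>k. pod_mex_gf (2 * k + 1)) sums Abs_fps (\<lambda>n. of_nat (a_od_o n))"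
proof -
  have "m \<in> range (\<lambda>k. 2 * k + 1) \<longleftrightarrow> odd m" for m :: nat
    by (auto elim!: oddE)
  moreover have "inj (\<lambda>k. 2 * k + 1 :: nat)"
    by (simp add: inj_def)
  ultimately show ?thesis
    using sums_gf_by_statistic[OF finite_P_od, where s = mex and f = "\<lambda>k. 2 * k + 1"]
    by (simp add: pod_mex_gf_def a_od_o_def)
qed

lemma sums_pod_mex_gf_even: "(\<lambda>k. pod_mex_gf (2 * k)) sums Abs_fps (\<lambda>n. of_nat (a_od_e n))"
proof -
  have "m \<in> range (\<lambda>k. 2 * k) \<longleftrightarrow> even m" for m :: nat
    by (auto elim!: evenE)
  moreover have "inj (\<lambda>k. 2 * k :: nat)"
    by (simp add: inj_def)
  ultimately show ?thesis
    using sums_gf_by_statistic[OF finite_P_od, where s = mex and f = "\<lambda>k. 2 * k"]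
    by (simp add: pod_mex_gf_def a_od_e_def)
qed

theorem theorem1p1:
  shows "Abs_fps (\<lambda>n. of_nat (a_od_o n)) =
           qpoch_inf (- q) (q\<^sup>2) / qpoch_inf (q\<^sup>2) (q\<^sup>2) *
             (\<Sum>n. q ^ (2 * n\<^sup>2 + n) / qpoch (- q) (q\<^sup>2) (n + 1))
       \<and> Abs_fps (\<lambda>n. of_nat (a_od_e n)) =
           qpoch_inf (- q) (q\<^sup>2) / qpoch_inf (q\<^sup>2) (q\<^sup>2) *
             (v2 - (\<Sum>n. q ^ (2 * n\<^sup>2 + n) / qpoch (- q) (q\<^sup>2) n))"
    (is "?O = ?R * ?S \<and> ?E = ?R * (v2 - ?T)")
proof
  have "(\<lambda>k. pod_mex_gf (2 * k + 1)) sums (?R * ?S)"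
    unfolding pod_mex_gf_odd
    by (intro sums_mult_left_topological summable_sums summable_fps_X_power_div_qpoch) simp
  with sums_pod_mex_gf_odd show "?O = ?R * ?S"
    by (rule sums_unique2)
  have "(\<lambda>k. pod_mex_gf (2 * k)) sums (?R * (v2 - ?T))"
    unfolding pod_mex_gf_even v2_def
    by (intro sums_mult_left_topological sums_diff_topological summable_sums
        summable_fps_X_power_div_qpoch le_twice_square_minus) simp
  with sums_pod_mex_gf_even show "?E = ?R * (v2 - ?T)"
    by (rule sums_unique2)
qed

end
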